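(* Consider the discrete-time system $x_{k+1}=A_kx_k+b_ku_k$ ($k\in\mathbb{Z}$) with $A_k\in\mathbb{R}^{n\times n}$, $b_k\in\mathbb{R}^{n\times1}$, and for $k\in\mathbb{Z}$ let $W_k=[\,b_k,\ A_kb_{k-1},\ A_kA_{k-1}b_{k-2},\ \dots,\ A_k\cdots A_{k-n+2}b_{k-n+1}\,]$. The system is completely controllable if and only if $W_k$ is nonsingular for every $k\in\mathbb{Z}$.
   Context: Complete controllability: for every $k\in\mathbb{Z}$ and every $\xi_s,\xi_f\in\mathbb{R}^n$ there are controls $u_k,\dots,u_{k+n-1}$ such that $x_k=\xi_s$ implies $x_{k+n}=\xi_f$. *)

theory Defs
  imports "Jordan_Normal_Form.Matrix"
begin

text \<open>State of x_{k+1} = A_k x_k + b_k u_k after j steps, starting at time k with x_k = xi.\<close>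
fun state :: "(int \<Rightarrow> real mat) \<Rightarrow> (int \<Rightarrow> real vec) \<Rightarrow> (int \<Rightarrow> real) \<Rightarrow> int \<Rightarrow> real vec \<Rightarrow> nat \<Rightarrow> real vec" where
  "state A b u k xi 0 = xi"
| "state A b u k xi (Suc j) =
     A (k + int j) *\<^sub>v state A b u k xi j + u (k + int j) \<cdot>\<^sub>v b (k + int j)"

definition completely_controllable :: "nat \<Rightarrow> (int \<Rightarrow> real mat) \<Rightarrow> (int \<Rightarrow> real vec) \<Rightarrow> bool" where
  "completely_controllable n A b \<longleftrightarrow>
     (\<forall>k. \<forall>xs \<in> carrier_vec n. \<forall>xf \<in> carrier_vec n.
        \<exists>u :: int \<Rightarrow> real. state A b u k xs n = xf)"

text \<open>aprod A k j = A_k A_{k-1} ... A_{k-j+1} (identity for j = 0).\<close>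
fun aprod :: "nat \<Rightarrow> (int \<Rightarrow> real mat) \<Rightarrow> int \<Rightarrow> nat \<Rightarrow> real mat" where
  "aprod n A k 0 = 1\<^sub>m n"
| "aprod n A k (Suc j) = aprod n A k j * A (k - int j)"

text \<open>W_k = [b_k, A_k b_{k-1}, ..., A_k ... A_{k-n+2} b_{k-n+1}].\<close>
definition Wmat :: "nat \<Rightarrow> (int \<Rightarrow> real mat) \<Rightarrow> (int \<Rightarrow> real vec) \<Rightarrow> int \<Rightarrow> real mat" where
  "Wmat n A b k = mat_of_cols n (map (\<lambda>j. aprod n A k j *\<^sub>v b (k - int j)) [0..<n])"

end

theory Submission
  imports Defs "Jordan_Normal_Form.Determinant"
begin

(* With K = k + n - 1, the state reached from x_k after n steps is affine in the inputs:
   x_{k+n} = (free response of x_k) + W_K (u_K, u_{K-1}, ..., u_{K-n+1}).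
   As the n inputs are arbitrary reals, complete controllability says exactly that every W_K
   maps R^n onto R^n, and a square matrix over a field is onto iff it is invertible. *)

lemma mat_of_cols_map_upt_carrier: "mat_of_cols n (map f [0..<m]) \<in> carrier_mat n m"
  using mat_of_cols_carrier(1)[of n "map f [0..<m]"]
  by (simp only: length_map length_upt diff_zero)

lemma invertible_mat_iff_surj_mult_mat_vec:
  fixes W :: "'a :: field mat"
  assumes W: "W \<in> carrier_mat n n"
  shows "invertible_mat W \<longleftrightarrow> (\<forall>y \<in> carrier_vec n. \<exists>x \<in> carrier_vec n. W *\<^sub>v x = y)"
proof
  assume "invertible_mat W"
  then obtain B where WB: "W * B = 1\<^sub>m n" and BW: "B * W = 1\<^sub>m (dim_row B)"
    using W unfolding invertible_mat_def inverts_mat_def by auto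
  have B: "B \<in> carrier_mat n n"
    using arg_cong[OF WB, of dim_col] arg_cong[OF BW, of dim_col] W by auto
  show "\<forall>y \<in> carrier_vec n. \<exists>x \<in> carrier_vec n. W *\<^sub>v x = y"
  proof
    fix y :: "'a vec" assume y: "y \<in> carrier_vec n"
    have "W *\<^sub>v (B *\<^sub>v y) = (W * B) *\<^sub>v y"
      using W B y by (rule assoc_mult_mat_vec[symmetric])
    also have "\<dots> = y"
      using WB y by simp
    finally have "W *\<^sub>v (B *\<^sub>v y) = y" .
    moreover have "B *\<^sub>v y \<in> carrier_vec n" using B y by simp
    ultimately show "\<exists>x \<in> carrier_vec n. W *\<^sub>v x = y" by blast
  qed
next
  assume surj: "\<forall>y \<in> carrier_vec n. \<exists>x \<in> carrier_vec n. W *\<^sub>v x = y"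
  obtain g where g: "\<And>y. y \<in> carrier_vec n \<Longrightarrow> g y \<in> carrier_vec n \<and> W *\<^sub>v g y = y"
    using bchoice[OF surj[unfolded Bex_def]] by blast
  define B where "B = mat_of_cols n (map (\<lambda>j. g (unit_vec n j)) [0..<n])"
  have B: "B \<in> carrier_mat n n"
    unfolding B_def by (rule mat_of_cols_map_upt_carrier)
  have WB: "W * B = 1\<^sub>m n"
  proof (rule mat_col_eqI)
    fix j assume "j < dim_col (1\<^sub>m n :: 'a mat)"
    then have j: "j < n" by simp
    have "col (W * B) j = W *\<^sub>v col B j" using W B j by (rule col_mult2)
    also have "col B j = g (unit_vec n j)" using g[of "unit_vec n j"] j by (simp add: B_def)
    also have "W *\<^sub>v g (unit_vec n j) = col (1\<^sub>m n) j" using g[of "unit_vec n j"] j by simp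
    finally show "col (W * B) j = col (1\<^sub>m n) j" .
  qed (use W B in auto)
  have "B * W = 1\<^sub>m n" using mat_mult_left_right_inverse[OF W B WB] .
  then show "invertible_mat W"
    unfolding invertible_mat_def inverts_mat_def using W B WB
    by (intro conjI exI[of _ B]) simp_all
qed

lemma mat_of_cols_Cons_mult_vCons:
  fixes a :: "'a :: comm_semiring_0"
  assumes "w \<in> carrier_vec n" "set ws \<subseteq> carrier_vec n" "v \<in> carrier_vec (length ws)"
  shows "mat_of_cols n (w # ws) *\<^sub>v vCons a v = a \<cdot>\<^sub>v w + mat_of_cols n ws *\<^sub>v v"
proof (rule eq_vecI)
  fix i assume "i < dim_vec (a \<cdot>\<^sub>v w + mat_of_cols n ws *\<^sub>v v)"
  then have i: "i < n" using assms by simp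
  show "(mat_of_cols n (w # ws) *\<^sub>v vCons a v) $ i = (a \<cdot>\<^sub>v w + mat_of_cols n ws *\<^sub>v v) $ i"
    using i assms
    by (simp add: mult_mat_vec_def scalar_prod_def row_def sum.atLeast0_lessThan_Suc_shift
        mat_of_cols_Cons_index_0 mat_of_cols_Cons_index_Suc mult.commute
        del: sum.op_ivl_Suc)
qed (use assms in simp)

lemma mult_mat_of_cols:
  assumes "M \<in> carrier_mat m n" "set ws \<subseteq> carrier_vec n"
  shows "M * mat_of_cols n ws = mat_of_cols m (map ((*\<^sub>v) M) ws)"
proof (rule mat_col_eqI)
  fix i assume "i < dim_col (mat_of_cols m (map ((*\<^sub>v) M) ws))"
  then have i: "i < length ws" by simp
  then have "ws ! i \<in> carrier_vec n" using assms(2) nth_mem by blast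
  moreover have "M *\<^sub>v ws ! i \<in> carrier_vec m" using assms(1) calculation by simp
  ultimately show "col (M * mat_of_cols n ws) i = col (mat_of_cols m (map ((*\<^sub>v) M) ws)) i"
    using col_mult2[OF assms(1) mat_of_cols_carrier(1) i] i by simp
qed (use assms in auto)

lemma aprod_carrier:
  assumes "\<And>k. A k \<in> carrier_mat n n"
  shows "aprod n A K j \<in> carrier_mat n n"
  using assms by (induction j) auto

lemma aprod_Suc_left:
  assumes A: "\<And>k. A k \<in> carrier_mat n n"
  shows "aprod n A (K + 1) (Suc j) = A (K + 1) * aprod n A K j"
proof (induction j)
  case 0
  show ?case using A[of "K + 1"] by simp
next
  case (Suc j)
  have "aprod n A (K + 1) (Suc (Suc j)) = A (K + 1) * aprod n A K j * A (K - int j)"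
    using Suc by simp
  also have "\<dots> = A (K + 1) * aprod n A K (Suc j)"
    using assoc_mult_mat[OF A aprod_carrier[of A n, OF A] A] by simp
  finally show ?case .
qed

lemma state_carrier:
  assumes "\<And>k. A k \<in> carrier_mat n n" "\<And>k. b k \<in> carrier_vec n" "xs \<in> carrier_vec n"
  shows "state A b u k xs j \<in> carrier_vec n"
  using assms by (induction j) (auto intro!: add_carrier_vec mult_mat_vec_carrier)

lemma state_superposition:
  assumes A: "\<And>k. A k \<in> carrier_mat n n" and b: "\<And>k. b k \<in> carrier_vec n"
    and xs: "xs \<in> carrier_vec n"
  shows "state A b u k xs j = state A b (\<lambda>_. 0) k xs j + state A b u k (0\<^sub>v n) j"
proof (induction j)
  case 0
  show ?case using xs by simp
next
  case (Suc j)
  let ?t = "k + int j"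
  let ?free = "state A b (\<lambda>_. 0) k xs j" and ?forced = "state A b u k (0\<^sub>v n) j"
  have free: "?free \<in> carrier_vec n"
    using A b xs by (rule state_carrier)
  have forced: "?forced \<in> carrier_vec n"
    using A b zero_carrier_vec by (rule state_carrier)
  have "state A b u k xs (Suc j) = A ?t *\<^sub>v ?free + A ?t *\<^sub>v ?forced + u ?t \<cdot>\<^sub>v b ?t"
    using Suc mult_add_distrib_mat_vec[OF A free forced] by simp
  also have "\<dots> = (A ?t *\<^sub>v ?free + 0 \<cdot>\<^sub>v b ?t) + (A ?t *\<^sub>v ?forced + u ?t \<cdot>\<^sub>v b ?t)"
    using mult_mat_vec_carrier[OF A[of ?t] free] mult_mat_vec_carrier[OF A[of ?t] forced]
      b[of ?t]
    by (intro eq_vecI) simp_all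
  finally show ?case by simp
qed

definition reach_mat ::
  "nat \<Rightarrow> (int \<Rightarrow> real mat) \<Rightarrow> (int \<Rightarrow> real vec) \<Rightarrow> int \<Rightarrow> nat \<Rightarrow> real mat" where
  "reach_mat n A b K j = mat_of_cols n (map (\<lambda>c. aprod n A K c *\<^sub>v b (K - int c)) [0..<j])"

lemma reach_mat_carrier: "reach_mat n A b K j \<in> carrier_mat n j"
  unfolding reach_mat_def by (rule mat_of_cols_map_upt_carrier)

lemma reach_mat_Suc_mult_vCons:
  assumes A: "\<And>k. A k \<in> carrier_mat n n" and b: "\<And>k. b k \<in> carrier_vec n"
    and v: "v \<in> carrier_vec j"
  shows "reach_mat n A b (K + 1) (Suc j) *\<^sub>v vCons a v
    = a \<cdot>\<^sub>v b (K + 1) + A (K + 1) *\<^sub>v (reach_mat n A b K j *\<^sub>v v)"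
proof -
  let ?cols = "map (\<lambda>c. aprod n A K c *\<^sub>v b (K - int c)) [0..<j]"
  have cols: "set ?cols \<subseteq> carrier_vec n"
    using mult_mat_vec_carrier[OF aprod_carrier[of A n, OF A] b] by auto
  have "map (\<lambda>c. aprod n A (K + 1) c *\<^sub>v b (K + 1 - int c)) [0..<Suc j]
    = b (K + 1) # map ((*\<^sub>v) (A (K + 1))) ?cols"
  proof -
    have "aprod n A (K + 1) (Suc c) *\<^sub>v b (K + 1 - int (Suc c))
      = A (K + 1) *\<^sub>v (aprod n A K c *\<^sub>v b (K - int c))" for c
      unfolding aprod_Suc_left[of A n, OF A]
      using assoc_mult_mat_vec[OF A aprod_carrier[of A n, OF A] b] by simp
    then show ?thesis
      using b[of "K + 1"] unfolding map_upt_Suc by (simp add: comp_def)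
  qed
  then have "reach_mat n A b (K + 1) (Suc j) *\<^sub>v vCons a v
    = mat_of_cols n (b (K + 1) # map ((*\<^sub>v) (A (K + 1))) ?cols) *\<^sub>v vCons a v"
    by (simp add: reach_mat_def)
  also have "\<dots> = a \<cdot>\<^sub>v b (K + 1) + mat_of_cols n (map ((*\<^sub>v) (A (K + 1))) ?cols) *\<^sub>v v"
    using b cols v
    by (intro mat_of_cols_Cons_mult_vCons) (auto intro: mult_mat_vec_carrier[OF A])
  also have "mat_of_cols n (map ((*\<^sub>v) (A (K + 1))) ?cols) = A (K + 1) * reach_mat n A b K j"
    unfolding reach_mat_def using mult_mat_of_cols[OF A cols] by simp
  also have "(A (K + 1) * reach_mat n A b K j) *\<^sub>v v = A (K + 1) *\<^sub>v (reach_mat n A b K j *\<^sub>v v)"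
    using A reach_mat_carrier v by (rule assoc_mult_mat_vec)
  finally show ?thesis .
qed

lemma state_from_zero:
  assumes A: "\<And>k. A k \<in> carrier_mat n n" and b: "\<And>k. b k \<in> carrier_vec n"
  shows "state A b u k (0\<^sub>v n) j
    = reach_mat n A b (k + int j - 1) j *\<^sub>v vec j (\<lambda>c. u (k + int j - 1 - int c))"
proof (induction j)
  case 0
  show ?case by (intro eq_vecI) (simp_all add: reach_mat_def mult_mat_vec_def scalar_prod_def)
next
  case (Suc j)
  let ?K = "k + int j - 1"
  let ?v = "vec j (\<lambda>c. u (?K - int c))"
  have "state A b u k (0\<^sub>v n) (Suc j)
    = A (?K + 1) *\<^sub>v (reach_mat n A b ?K j *\<^sub>v ?v) + u (?K + 1) \<cdot>\<^sub>v b (?K + 1)"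
    using Suc by simp
  also have "\<dots> = u (?K + 1) \<cdot>\<^sub>v b (?K + 1) + A (?K + 1) *\<^sub>v (reach_mat n A b ?K j *\<^sub>v ?v)"
  proof (rule comm_add_vec)
    show "A (?K + 1) *\<^sub>v (reach_mat n A b ?K j *\<^sub>v ?v) \<in> carrier_vec n"
      using A reach_mat_carrier by (intro mult_mat_vec_carrier) auto
  qed (use b in simp)
  also have "\<dots> = reach_mat n A b (?K + 1) (Suc j) *\<^sub>v vCons (u (?K + 1)) ?v"
    using A b by (rule reach_mat_Suc_mult_vCons[symmetric]) simp
  also have "vCons (u (?K + 1)) ?v = vec (Suc j) (\<lambda>c. u (?K + 1 - int c))"
    by (simp add: vec_Suc comp_def algebra_simps)
  finally show ?case by (simp add: algebra_simps)
qed

lemma Wmat_eq_reach_mat: "Wmat n A b K = reach_mat n A b K n"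
  unfolding Wmat_def reach_mat_def ..

lemma state_eq_free_plus_Wmat:
  assumes A: "\<And>k. A k \<in> carrier_mat n n" and b: "\<And>k. b k \<in> carrier_vec n"
    and xs: "xs \<in> carrier_vec n"
  shows "state A b u k xs n = state A b (\<lambda>_. 0) k xs n
    + Wmat n A b (k + int n - 1) *\<^sub>v vec n (\<lambda>c. u (k + int n - 1 - int c))"
proof -
  have "state A b u k xs n = state A b (\<lambda>_. 0) k xs n + state A b u k (0\<^sub>v n) n"
    using A b xs by (rule state_superposition)
  also have "state A b u k (0\<^sub>v n) n
    = Wmat n A b (k + int n - 1) *\<^sub>v vec n (\<lambda>c. u (k + int n - 1 - int c))"
    unfolding Wmat_eq_reach_mat using A b by (rule state_from_zero)
  finally show ?thesis .
qed

lemma completely_controllable_iff_Wmat_surj: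
  assumes A: "\<And>k. A k \<in> carrier_mat n n" and b: "\<And>k. b k \<in> carrier_vec n"
  shows "completely_controllable n A b
    \<longleftrightarrow> (\<forall>K. \<forall>y \<in> carrier_vec n. \<exists>x \<in> carrier_vec n. Wmat n A b K *\<^sub>v x = y)"
proof
  assume ctrb: "completely_controllable n A b"
  show "\<forall>K. \<forall>y \<in> carrier_vec n. \<exists>x \<in> carrier_vec n. Wmat n A b K *\<^sub>v x = y"
  proof (intro allI ballI)
    fix K and y :: "real vec" assume y: "y \<in> carrier_vec n"
    obtain u where u: "state A b u (K - int n + 1) (0\<^sub>v n) n = y"
      using ctrb[unfolded completely_controllable_def, rule_format, OF zero_carrier_vec y] ..
    have K: "K - int n + 1 + int n - 1 = K" by simp
    have "Wmat n A b K *\<^sub>v vec n (\<lambda>c. u (K - int c)) = y"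
      using state_from_zero[of A n b u "K - int n + 1" n, OF A b]
      unfolding u K Wmat_eq_reach_mat by (rule sym)
    then show "\<exists>x \<in> carrier_vec n. Wmat n A b K *\<^sub>v x = y"
      by (rule bexI[OF _ vec_carrier])
  qed
next
  assume surj: "\<forall>K. \<forall>y \<in> carrier_vec n. \<exists>x \<in> carrier_vec n. Wmat n A b K *\<^sub>v x = y"
  show "completely_controllable n A b"
    unfolding completely_controllable_def
  proof (intro allI ballI)
    fix k and xs xf :: "real vec" assume xs: "xs \<in> carrier_vec n" and xf: "xf \<in> carrier_vec n"
    let ?K = "k + int n - 1"
    let ?free = "state A b (\<lambda>_. 0) k xs n"
    have free: "?free \<in> carrier_vec n"
      using A b xs by (rule state_carrier)
    obtain x where x: "x \<in> carrier_vec n" and Wx: "Wmat n A b ?K *\<^sub>v x = xf - ?free"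
      using surj[rule_format, OF minus_carrier_vec[OF xf free]] ..
    define u where "u t = x $ nat (?K - t)" for t
    have "vec n (\<lambda>c. u (?K - int c)) = x"
      using x by (intro eq_vecI) (simp_all add: u_def)
    then have "state A b u k xs n = ?free + (xf - ?free)"
      using state_eq_free_plus_Wmat[of A n b xs u k, OF A b xs] Wx by simp
    also have "\<dots> = xf"
      using free xf by (intro eq_vecI) simp_all
    finally show "\<exists>u. state A b u k xs n = xf" by blast
  qed
qed

theorem claim1:
  fixes n :: nat and A :: "int \<Rightarrow> real mat" and b :: "int \<Rightarrow> real vec"
  assumes "\<And>k. A k \<in> carrier_mat n n"
    and "\<And>k. b k \<in> carrier_vec n"
  shows "completely_controllable n A b \<longleftrightarrow> (\<forall>k. invertible_mat (Wmat n A b k))"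
proof -
  have W: "Wmat n A b k \<in> carrier_mat n n" for k
    unfolding Wmat_def by (rule mat_of_cols_map_upt_carrier)
  have "completely_controllable n A b
    \<longleftrightarrow> (\<forall>k. \<forall>y \<in> carrier_vec n. \<exists>x \<in> carrier_vec n. Wmat n A b k *\<^sub>v x = y)"
    using assms by (rule completely_controllable_iff_Wmat_surj)
  also have "\<dots> \<longleftrightarrow> (\<forall>k. invertible_mat (Wmat n A b k))"
    using invertible_mat_iff_surj_mult_mat_vec[OF W] by simp
  finally show ?thesis .
qed

end
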